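(* (The Mahler conjecture holds for isocanted cubes.) For each integer $d\ge2$ and all real parameters $0<a<\ell$, $$\frac{4^d}{d!}\le \operatorname{vol}_d\big(\mathcal{I}_d(\ell,a)\big)\,\operatorname{vol}_d\big(\mathcal{I}_d^\circ(\ell,a)\big).$$
   Context: For an integer $d\ge2$ and real numbers $0<a<\ell$, the isocanted cube $\mathcal{I}_d(\ell,a)\subseteq\mathbb{R}^d$ is the convex polytope $$\mathcal{I}_d(\ell,a)=\Big\{x\in\mathbb{R}^d:\ -\tfrac{\ell}{2}\le x_j\le \tfrac{\ell}{2},\ \ a-\ell\le x_j-x_k\le \ell-a\ \text{ for all } j,k\in\{1,\dots,d\},\ j\ne k\Big\}.$$ The polar dual of a set $K\subseteq\mathbb{R}^d$ is $K^\circ:=\{x\in\mathbb{R}^d:\langle x,y\rangle\le 1\ \forall y\in K\}$, with the usual inner product, and $\mathcal{I}_d^\circ(\ell,a):=(\mathcal{I}_d(\ell,a))^\circ$. $\operatorname{vol}_d$ is $d$-dimensional Lebesgue measure. The number $4^d/d!$ is the product of the volumes of a $d$-cube centered at the origin and of its polar dual. *)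

theory Defs
  imports "HOL-Analysis.Analysis"
begin

(* The dimension d is the cardinality of the index type 'n. *)
definition isocanted_cube :: "real \<Rightarrow> real \<Rightarrow> (real ^ 'n) set" where
  "isocanted_cube l a =
     {x. (\<forall>j. - (l / 2) \<le> x $ j \<and> x $ j \<le> l / 2) \<and>
         (\<forall>j k. j \<noteq> k \<longrightarrow> a - l \<le> x $ j - x $ k \<and> x $ j - x $ k \<le> l - a)}"

definition polar_dual :: "'a::real_inner set \<Rightarrow> 'a set" where
  "polar_dual K = {x. \<forall>y\<in>K. x \<bullet> y \<le> 1}"

end

(*
  Put c = a / (l - a). The isocanted cube is the Minkowski sum of a cube of side l - a and the
  segment spanned by a (1,...,1), so its polar dual is the unit ball of
  (l - a)/2 * |x|_1 + a/2 * |sum of x|, and its volume is (l - a)^d * (1 + d c). Integrating the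
  exponential of minus this norm, the claim becomes F(d, c) * (1 + d c) >= 2^d, where F(d, c) is the
  integral of exp (-|x|_1 - c * |sum of x|) over R^d. Integrating out one coordinate gives a recursion
  in d that expresses F(d, c) through F(d-1, c) and F(d-1, 1), and hence a closed form with partial
  sums of binomial(n + j, j) z^j, z = (1 + c)/2, n = d - 1. In w = 1/z the claim is a polynomial
  inequality on (0, 2] with a single sign change of the coefficients, which reduces it to the end
  points: w = 2 (the cube, equality) and w = 0 (4^n <= (n + 1) * binomial(2 n, n)).
*)
theory Submission
  imports Defs "HOL-Probability.Distributions" "HOL-Real_Asymp.Real_Asymp"
begin

section \<open>Partial binomial sums and their recursion\<close>

definition binom_sum :: "nat \<Rightarrow> real \<Rightarrow> real" where
  "binom_sum n z = (\<Sum>j\<le>n. real ((n + j) choose j) * z ^ j)"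

lemma choose_even_middle: "((2 * n + 2) choose (n + 1)) = 2 * ((2 * n + 1) choose (n + 1))"
proof -
  have "((2 * n + 1) choose n) = ((2 * n + 1) choose (n + 1))"
    by (subst binomial_symmetric) simp_all
  then show ?thesis by simp
qed

text \<open>Pascal's rule splits every term of \<open>binom_sum (Suc n) z\<close> in two. One half
  reassembles to \<open>binom_sum n z\<close> plus a boundary term, the other to z times
  \<open>binom_sum (Suc n) z\<close> without its top term; \<open>choose_even_middle\<close> merges
  the two boundary terms. At z = 1 the left side vanishes and gives the value there, at z = 1/2 the
  correction vanishes and gives doubling.\<close>

lemma binom_sum_Suc:
  "(1 - z) * binom_sum (Suc n) z
     = binom_sum n z - (2 * z - 1) * z ^ (n + 1) * real ((2 * n + 1) choose (n + 1))"
proof -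
  have "binom_sum (Suc n) z = 1 + (\<Sum>j\<le>n. real ((n + 2 + j) choose (Suc j)) * z ^ Suc j)"
    unfolding binom_sum_def by (subst sum.atMost_Suc_shift) simp
  also have "\<dots> = 1 + (\<Sum>j\<le>n. real ((n + Suc j) choose (Suc j)) * z ^ Suc j)
      + (\<Sum>j\<le>n. real ((Suc n + j) choose j) * z ^ Suc j)"
    by (simp add: sum.distrib[symmetric] algebra_simps)
  also have "1 + (\<Sum>j\<le>n. real ((n + Suc j) choose (Suc j)) * z ^ Suc j)
      = (\<Sum>j\<le>Suc n. real ((n + j) choose j) * z ^ j)"
    by (subst sum.atMost_Suc_shift) simp
  also have "\<dots> = binom_sum n z + real ((2 * n + 1) choose (n + 1)) * z ^ (n + 1)"
    by (simp add: binom_sum_def mult_2)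
  also have "(\<Sum>j\<le>n. real ((Suc n + j) choose j) * z ^ Suc j)
      = z * binom_sum (Suc n) z - real ((2 * n + 2) choose (n + 1)) * z ^ (n + 2)"
    by (simp add: binom_sum_def sum_distrib_left algebra_simps flip: mult_2_right)
  finally show ?thesis
    by (simp only: choose_even_middle) (simp add: algebra_simps)
qed

lemma binom_sum_1: "binom_sum n 1 = real ((2 * n + 1) choose (n + 1))"
  using binom_sum_Suc[of 1 n] by simp

lemma binom_sum_half: "binom_sum n (1 / 2) = 2 ^ n"
proof (induction n)
  case (Suc n)
  then show ?case using binom_sum_Suc[of "1 / 2" n] by simp
qed (simp add: binom_sum_def)

section \<open>The polynomial inequality in w = 1/z\<close>

lemma four_power_le_central_binomial: "4 ^ n \<le> (n + 1) * ((2 * n) choose n)"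
proof (induction n)
  case (Suc n)
  have rec: "(n + 1) * ((2 * n + 2) choose (n + 1)) = 2 * (2 * n + 1) * ((2 * n) choose n)"
  proof -
    have "Suc n * (Suc (2 * n) choose Suc n) = Suc (2 * n) * ((2 * n) choose n)"
      by (metis Suc_times_binomial_eq mult.commute)
    then have "(n + 1) * ((2 * n + 1) choose (n + 1)) = (2 * n + 1) * ((2 * n) choose n)"
      by (simp only: Suc_eq_plus1)
    then show ?thesis
      by (simp only: choose_even_middle mult.assoc mult.left_commute[of "n + 1" 2])
  qed
  \<comment> \<open>The ratio of consecutive central binomials is 2 (2 n + 1) / (n + 1). Everything
    is multiplied by n + 1 to stay in the naturals, and what remains is 2 (n + 1)^2 <= (n + 2) (2 n
    + 1).\<close>
  have "(n + 1) * 4 ^ Suc n = 4 * (n + 1) * 4 ^ n" by (simp add: algebra_simps)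
  also have "\<dots> \<le> 4 * (n + 1) * ((n + 1) * ((2 * n) choose n))"
    using Suc by (intro mult_left_mono) auto
  also have "\<dots> = 2 * (2 * (n + 1) * (n + 1)) * ((2 * n) choose n)" by (simp add: algebra_simps)
  also have "\<dots> \<le> 2 * ((n + 2) * (2 * n + 1)) * ((2 * n) choose n)"
    by (intro mult_right_mono mult_left_mono) (auto simp: algebra_simps)
  also have "\<dots> = (n + 2) * (2 * (2 * n + 1) * ((2 * n) choose n))" by (simp add: algebra_simps)
  also have "\<dots> = (n + 1) * ((n + 2) * ((2 * n + 2) choose (n + 1)))"
    by (simp only: rec[symmetric] mult.left_commute)
  finally have "4 ^ Suc n \<le> (n + 2) * ((2 * n + 2) choose (n + 1))"
    by (subst (asm) mult_le_cancel1) simp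
  then show ?case by simp
qed simp

text \<open>The coefficient of w^k in w^n * \<open>binom_sum n (1 / w)\<close>: the term j = n - k,
  with the binomial written symmetrically. For n >= 1 it vanishes beyond k = n, because its upper
  entry drops below n.\<close>

definition rev_coeff :: "nat \<Rightarrow> nat \<Rightarrow> real" where
  "rev_coeff n k = real ((2 * n - k) choose n)"

text \<open>The ratio of consecutive coefficients, cross-multiplied to avoid division. It comes from
  the absorption identity and serves to find the signs of the expanded product below.\<close>

lemma rev_coeff_Suc:
  assumes "k \<le> n"
  shows "real (2 * n - k) * rev_coeff n (Suc k) = real (n - k) * rev_coeff n k"
proof (cases "n = k \<or> n = 0")
  case True
  then show ?thesis using assms by (auto simp: rev_coeff_def)
next
  case False
  then have lt: "k < n" using assms by auto
  obtain N where N: "2 * n - k = Suc N" "2 * n - Suc k = N"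
    using lt by (metis Suc_diff_Suc mult_2 trans_less_add1)
  have "(Suc N - n) * (Suc N choose n) = Suc N * (N choose n)"
    using binomial_absorb_comp[of "Suc N" n] by (simp only: diff_Suc_1)
  moreover have "Suc N - n = n - k" using N lt by auto
  ultimately show ?thesis
    unfolding rev_coeff_def N by (metis of_nat_mult mult.commute)
qed

lemma sum_rev_coeff:
  assumes "w \<noteq> 0"
  shows "(\<Sum>k\<le>n. rev_coeff n k * w ^ k) = w ^ n * binom_sum n (1 / w)"
proof -
  have "(\<Sum>k\<le>n. rev_coeff n k * w ^ k) = (\<Sum>j\<le>n. rev_coeff n (n - j) * w ^ (n - j))"
    by (rule sum.nat_diff_reindex[of _ "Suc n", simplified lessThan_Suc_atMost, simplified, symmetric])
  also have "\<dots> = (\<Sum>j\<le>n. w ^ n * (real ((n + j) choose j) * (1 / w) ^ j))"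
  proof (rule sum.cong)
    fix j assume "j \<in> {..n}"
    then have j: "j \<le> n" by simp
    have "((2 * n - (n - j)) choose n) = ((n + j) choose j)"
      using j by (subst binomial_symmetric) (auto simp: algebra_simps)
    moreover have "w ^ (n - j) = w ^ n * (1 / w) ^ j"
      using j assms by (simp add: power_diff power_one_over field_simps)
    ultimately show "rev_coeff n (n - j) * w ^ (n - j) = w ^ n * (real ((n + j) choose j) * (1 / w) ^ j)"
      by (simp add: rev_coeff_def)
  qed simp
  finally show ?thesis by (simp add: binom_sum_def sum_distrib_left)
qed

text \<open>Let p(w) be the right side and r = w/2. The signs of the coefficients of p, compared
  with the power w^2, give p(w) >= (1 - r^2) p(0) + r^2 p(2). Both end values are at least 2 * 4^n,
  so this convex combination is too.\<close>

lemma rev_coeff_sum_lower_bound: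
  assumes n: "n \<ge> 1" and w: "0 < w" "w \<le> 2"
  shows "2 * 4 ^ n \<le> (2 * (real n + 1) - real n * w) * (\<Sum>k\<le>n. rev_coeff n k * w ^ k)"
proof -
  \<comment> \<open>\<open>b k\<close> is the coefficient of w^(k+1) in the product and
    \<open>b0\<close> is the constant term.\<close>
  define b where "b k = 2 * (real n + 1) * rev_coeff n (Suc k) - real n * rev_coeff n k" for k
  define b0 where "b0 = 2 * (real n + 1) * rev_coeff n 0"
  define r where "r = w / 2"
  have r: "0 < r" "r \<le> 1" "w = r * 2" using w by (auto simp: r_def)
  have expand: "(2 * (real n + 1) - real n * v) * (\<Sum>k\<le>n. rev_coeff n k * v ^ k)
      = b0 + (\<Sum>k\<le>n. b k * v ^ Suc k)" for v
  proof -
    \<comment> \<open>The extra zero coefficient lets the shifted sum run up to k = n as well. Here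
      n >= 1 matters: for n = 0 truncated subtraction would make it 1.\<close>
    have "rev_coeff n (Suc n) = 0" using n by (simp add: rev_coeff_def)
    then have "(\<Sum>k\<le>n. rev_coeff n k * v ^ k) = (\<Sum>k\<le>Suc n. rev_coeff n k * v ^ k)" by simp
    also have "\<dots> = rev_coeff n 0 + (\<Sum>k\<le>n. rev_coeff n (Suc k) * v ^ Suc k)"
      by (subst sum.atMost_Suc_shift) simp
    finally have shift: "(\<Sum>k\<le>n. rev_coeff n k * v ^ k)
      = rev_coeff n 0 + (\<Sum>k\<le>n. rev_coeff n (Suc k) * v ^ Suc k)" .
    have "(2 * (real n + 1) - real n * v) * (\<Sum>k\<le>n. rev_coeff n k * v ^ k)
      = 2 * (real n + 1) * (\<Sum>k\<le>n. rev_coeff n k * v ^ k) - real n * v * (\<Sum>k\<le>n. rev_coeff n k * v ^ k)"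
      by (simp add: left_diff_distrib)
    also have "\<dots> = b0 + 2 * (real n + 1) * (\<Sum>k\<le>n. rev_coeff n (Suc k) * v ^ Suc k)
        - real n * v * (\<Sum>k\<le>n. rev_coeff n k * v ^ k)"
      by (subst (1) shift) (simp add: b0_def algebra_simps)
    also have "\<dots> = b0 + (\<Sum>k\<le>n. b k * v ^ Suc k)"
    proof -
      have "(\<Sum>k\<le>n. b k * v ^ Suc k) = (\<Sum>k\<le>n. 2 * (real n + 1) * (rev_coeff n (Suc k) * v ^ Suc k)
          - real n * v * (rev_coeff n k * v ^ k))"
        by (intro sum.cong) (auto simp: b_def algebra_simps)
      then show ?thesis by (simp only: sum_subtractf sum_distrib_left add_diff_eq)
    qed
    finally show ?thesis .
  qed
  \<comment> \<open>Eliminating the next coefficient by the ratio identity shows that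
    \<open>b k\<close> has the sign of 2 n - (n + 2) k, up to zeros. For k = 1 this sign depends on
    n, which is why r^2 is the reference power: the term k = 1 then gives equality.\<close>
  have bk: "(2 * real n - k) * b k = rev_coeff n k * (2 * real n - (real n + 2) * (k::nat))" if "k \<le> n" for k
  proof -
    have "(2 * real n - k) * rev_coeff n (Suc k) = (real n - k) * rev_coeff n k"
      using rev_coeff_Suc[OF that] that by (simp add: of_nat_diff)
    then have "(2 * real n - k) * b k
        = 2 * (real n + 1) * ((real n - k) * rev_coeff n k) - real n * (2 * real n - k) * rev_coeff n k"
      unfolding b_def by (simp only: right_diff_distrib mult.left_commute[of "2 * real n - k"]) (simp add: algebra_simps)
    then show ?thesis by (simp add: algebra_simps)
  qed
  have nn: "rev_coeff n k \<ge> 0" for k by (simp add: rev_coeff_def)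
  (* b k is nonnegative for k = 0 and nonpositive for k >= 2, so on (0, 2] every term of the
     expansion is at least r^2 times its value at w = 2. *)
  have term_ge: "b k * w ^ Suc k \<ge> r\<^sup>2 * (b k * 2 ^ Suc k)" if k: "k \<le> n" for k
  proof -
    have pos: "2 * real n - k > 0" using k n by auto
    consider "k = 0" | "k = 1" | "k \<ge> 2" by linarith
    then have "b k * r ^ Suc k \<ge> b k * r\<^sup>2"
    proof cases
      case 1
      have "b k \<ge> 0" using bk[OF k] pos nn[of k] 1 n by (simp add: zero_le_mult_iff)
      moreover have "r\<^sup>2 \<le> r ^ Suc k" using r 1 by (simp add: power2_eq_square)
      ultimately show ?thesis by (rule mult_left_mono[rotated])
    next
      case 2
      then show ?thesis by (simp add: power2_eq_square)
    next
      case 3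
      have "(real n + 2) * 2 \<le> (real n + 2) * k" using 3 by (intro mult_left_mono) auto
      then have "rev_coeff n k * (2 * real n - (real n + 2) * k) \<le> 0"
        using nn[of k] by (intro mult_nonneg_nonpos) auto
      then have "b k \<le> 0" using bk[OF k] pos by (metis mult_le_0_iff not_less)
      moreover have "r ^ Suc k \<le> r\<^sup>2" using r 3 by (intro power_decreasing) auto
      ultimately show ?thesis by (rule mult_left_mono_neg[rotated])
    qed
    then have "(b k * r\<^sup>2) * 2 ^ Suc k \<le> (b k * r ^ Suc k) * 2 ^ Suc k"
      by (rule mult_right_mono) simp
    then show ?thesis unfolding r(3) power_mult_distrib by (simp only: mult_ac)
  qed
  \<comment> \<open>At w = 2 the linear factor is 2 and the sum is 2^n *
    \<open>binom_sum n (1 / 2)\<close> = 4^n.\<close>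
  have at2: "b0 + (\<Sum>k\<le>n. b k * 2 ^ Suc k) = 2 * 4 ^ n"
  proof -
    have "(4::real) ^ n = 2 ^ n * 2 ^ n" by (simp add: power_mult_distrib[symmetric])
    then show ?thesis
      unfolding expand[symmetric] by (subst sum_rev_coeff) (simp_all add: binom_sum_half)
  qed
  have at0: "b0 \<ge> 2 * 4 ^ n"
  proof -
    have "real (4 ^ n) \<le> real ((n + 1) * ((2 * n) choose n))"
      by (rule of_nat_mono[OF four_power_le_central_binomial])
    then show ?thesis by (simp add: b0_def rev_coeff_def algebra_simps)
  qed
  have r2: "0 \<le> r\<^sup>2" "r\<^sup>2 \<le> 1" using r by (auto simp: power_le_one)
  have "2 * 4 ^ n = (1 - r\<^sup>2) * (2 * 4 ^ n) + r\<^sup>2 * (2 * 4 ^ n)" by (simp add: algebra_simps)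
  also have "\<dots> \<le> (1 - r\<^sup>2) * b0 + r\<^sup>2 * (b0 + (\<Sum>k\<le>n. b k * 2 ^ Suc k))"
    unfolding at2 using at0 r2 by (intro add_right_mono mult_left_mono) auto
  also have "\<dots> = b0 + (\<Sum>k\<le>n. r\<^sup>2 * (b k * 2 ^ Suc k))" by (simp add: algebra_simps sum_distrib_left)
  also have "\<dots> \<le> b0 + (\<Sum>k\<le>n. b k * w ^ Suc k)"
    using term_ge by (intro add_left_mono sum_mono) auto
  finally show ?thesis unfolding expand .
qed

text \<open>With w = 2 / (1 + c) one has 1 + (n + 1) c = (2 (n + 1) - n w) / w, so this is the
  polynomial inequality after a factor 2^n is cancelled. The half line c >= 0 corresponds to 0 < w
  <= 2.\<close>

lemma binom_sum_lower_bound: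
  assumes n: "n \<ge> 1" and c: "0 \<le> c"
  shows "2 ^ (n + 1) \<le> (1 + real (n + 1) * c) * (2 * binom_sum n ((1 + c) / 2) / (1 + c) ^ (n + 1))"
proof -
  define w where "w = 2 / (1 + c)"
  have w: "0 < w" "w \<le> 2" using c by (auto simp: w_def field_simps)
  have c': "1 + c = 2 / w" "c = 2 / w - 1" using c by (auto simp: w_def field_simps)
  have "2 * 4 ^ n \<le> (2 * (real n + 1) - real n * w) * (w ^ n * binom_sum n (1 / w))"
    using rev_coeff_sum_lower_bound[OF n w] w by (simp add: sum_rev_coeff)
  also have "\<dots> = 2 ^ n * ((1 + real (n + 1) * c) * (2 * binom_sum n ((1 + c) / 2) / (1 + c) ^ (n + 1)))"
    using w unfolding c'(1) unfolding c'(2) by (simp add: power_divide field_simps)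
  also have "(2::real) * 4 ^ n = 2 ^ n * 2 ^ (n + 1)" by (simp add: power_mult_distrib[symmetric])
  finally show ?thesis by (subst (asm) mult_le_cancel_left_pos) simp_all
qed

section \<open>One-dimensional exponential integrals\<close>

lemma nn_integral_exp_Icc:
  fixes p q :: real
  assumes "p \<noteq> 0" "a \<le> b"
  shows "(\<integral>\<^sup>+y. ennreal (exp (q + p * y)) * indicator {a..b} y \<partial>lborel)
    = ennreal ((exp (q + p * b) - exp (q + p * a)) / p)"
  using assms by (subst nn_integral_FTC_Icc[where F = "\<lambda>y. exp (q + p * y) / p"])
     (auto intro!: derivative_eq_intros simp: diff_divide_distrib)

lemma nn_integral_exp_atLeast:
  fixes p q :: real
  assumes "p > 0"
  shows "(\<integral>\<^sup>+y. ennreal (exp (q - p * y)) * indicator {a..} y \<partial>lborel) = ennreal (exp (q - p * a) / p)"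
proof -
  have "((\<lambda>y. - exp (q - p * y) / p) \<longlongrightarrow> 0) at_top"
    using assms by real_asymp
  then show ?thesis
    using assms by (subst nn_integral_FTC_atLeast[where F = "\<lambda>y. - exp (q - p * y) / p"])
      (auto intro!: derivative_eq_intros)
qed

text \<open>For s >= 0 the kinks at 0 and -s cut the line into three pieces with linear exponent, of
  value A, B and C; negative s follows by reflecting y. The exponent has slope 1 - c on the middle
  piece, hence the exclusion of c = 1.\<close>

lemma nn_integral_laplace_kernel:
  fixes c s :: real
  assumes c: "c > 0" "c \<noteq> 1"
  shows "(\<integral>\<^sup>+y. ennreal (exp (- (\<bar>y\<bar> + c * \<bar>s + y\<bar>))) \<partial>lborel)
    = ennreal (2 * (exp (- c * \<bar>s\<bar>) - c * exp (- \<bar>s\<bar>)) / (1 - c\<^sup>2))"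
proof -
  have nonneg_case: "(\<integral>\<^sup>+y. ennreal (exp (- (\<bar>y\<bar> + c * \<bar>s + y\<bar>))) \<partial>lborel)
      = ennreal (2 * (exp (- c * s) - c * exp (- s)) / (1 - c\<^sup>2))" if s: "s \<ge> 0" for s
  proof -
    define A B C where "A = ennreal (exp (- c * s) / (1 + c))"
      and "B = ennreal (exp (- c * s) / (1 - c) - exp (- s) / (1 - c))"
      and "C = ennreal (exp (- s) / (1 + c))"
    have "- y - c * (s + y) = - c * s - (1 + c) * y" "y - c * (s + y) = - c * s + (1 - c) * y"
      "- y + c * (s - y) = c * s - (1 + c) * y" for y
      by (simp_all add: algebra_simps)
    note linear = this
    have A: "(\<integral>\<^sup>+y. ennreal (exp (- y - c * (s + y))) * indicator {0..} y \<partial>lborel) = A"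
      unfolding A_def linear using nn_integral_exp_atLeast[of "1 + c" "- c * s" 0] c by simp
    have "- c * s + (1 - c) * - s = - s" by (simp add: algebra_simps)
    then have B: "(\<integral>\<^sup>+y. ennreal (exp (y - c * (s + y))) * indicator {-s..0} y \<partial>lborel) = B"
      unfolding B_def linear using nn_integral_exp_Icc[of "1 - c" "- s" 0 "- c * s"] c s
      by (simp add: diff_divide_distrib)
    have "c * s - (1 + c) * s = - s" by (simp add: algebra_simps)
    then have "(\<integral>\<^sup>+y. ennreal (exp (- y + c * (s - y))) * indicator {s..} y \<partial>lborel) = C"
      unfolding C_def linear using nn_integral_exp_atLeast[of "1 + c" "c * s" s] c by simp
    moreover have "indicator {..- s} (- y) = (indicator {s..} y :: ennreal)" for y
      by (simp add: indicator_def)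
    ultimately have C: "(\<integral>\<^sup>+y. ennreal (exp (y + c * (s + y))) * indicator {..-s} y \<partial>lborel) = C"
      by (subst nn_integral_real_affine[of _ "-1" 0]) simp_all
    have "AE y in lborel. ennreal (exp (- (\<bar>y\<bar> + c * \<bar>s + y\<bar>)))
        = ennreal (exp (- y - c * (s + y))) * indicator {0..} y
          + ennreal (exp (y - c * (s + y))) * indicator {-s..0} y
          + ennreal (exp (y + c * (s + y))) * indicator {..-s} y"
      \<comment> \<open>The three closed pieces overlap at their end points, so the splitting holds
        only off the null set {0, -s}.\<close>
      using AE_lborel_singleton[of 0] AE_lborel_singleton[of "-s"]
    proof eventually_elim
      case (elim y)
      consider "y > 0" | "y < 0" "y > -s" | "y < -s" using elim by linarith
      then show ?case using s by cases (auto simp: algebra_simps)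
    qed
    then have "(\<integral>\<^sup>+y. ennreal (exp (- (\<bar>y\<bar> + c * \<bar>s + y\<bar>))) \<partial>lborel) = A + B + C"
      unfolding A[symmetric] B[symmetric] C[symmetric]
      by (subst nn_integral_cong_AE, assumption) (simp add: nn_integral_add)
    also have "\<dots> = ennreal (exp (- c * s) / (1 + c) + (exp (- c * s) / (1 - c) - exp (- s) / (1 - c))
        + exp (- s) / (1 + c))"
    proof -
      \<comment> \<open>The middle value must be nonnegative for the sum in \<open>ennreal\<close>
        to be the real sum. Difference of exponentials and denominator change sign together at c =
        1.\<close>
      have "0 \<le> exp (- c * s) / (1 - c) - exp (- s) / (1 - c)"
      proof (cases "c < 1")
        case True
        then have "c * s \<le> s" using s by (simp add: mult_left_le_one_le c less_imp_le)
        then show ?thesis using True by (simp add: divide_right_mono)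
      next
        case False
        then have "s \<le> c * s" using s by (simp add: mult_le_cancel_right1)
        then show ?thesis using False c by (simp add: divide_right_mono_neg)
      qed
      then show ?thesis unfolding A_def B_def C_def using c by (simp flip: ennreal_plus)
    qed
    also have "exp (- c * s) / (1 + c) + (exp (- c * s) / (1 - c) - exp (- s) / (1 - c)) + exp (- s) / (1 + c)
        = 2 * (exp (- c * s) - c * exp (- s)) / (1 - c\<^sup>2)"
    proof -
      have "(1 - c\<^sup>2) = (1 - c) * (1 + c)" by (simp add: power2_eq_square algebra_simps)
      moreover have "1 - c \<noteq> 0" "1 + c \<noteq> 0" using c by auto
      ultimately show ?thesis by (simp add: divide_simps) (simp add: algebra_simps)
    qed
    finally show ?thesis .
  qed
  show ?thesis
  proof (cases "s \<ge> 0")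
    case True
    then show ?thesis using nonneg_case[of s] by simp
  next
    case False
    have "(\<integral>\<^sup>+y. ennreal (exp (- (\<bar>y\<bar> + c * \<bar>s + y\<bar>))) \<partial>lborel)
        = (\<integral>\<^sup>+y. ennreal (exp (- (\<bar>y\<bar> + c * \<bar>- s + y\<bar>))) \<partial>lborel)"
      by (subst nn_integral_real_affine[of _ "-1" 0])
         (auto intro!: nn_integral_cong simp: abs_minus_commute)
    then show ?thesis using nonneg_case[of "- s"] False by simp
  qed
qed

section \<open>The d-dimensional integral and its closed form\<close>

definition laplace_integral :: "'i set \<Rightarrow> real \<Rightarrow> ennreal" where
  "laplace_integral I c =
     (\<integral>\<^sup>+x. ennreal (exp (- ((\<Sum>i\<in>I. \<bar>x i\<bar>) + c * \<bar>\<Sum>i\<in>I. x i\<bar>))) \<partial>Pi\<^sub>M I (\<lambda>_. lborel))"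

text \<open>The closed form of the integral over d coordinates. Dimension 0 is separate: the empty
  product is a point of mass 1, while the formula with truncated d - 1 would give 2.\<close>

definition laplace_value :: "nat \<Rightarrow> real \<Rightarrow> real" where
  "laplace_value d c = (if d = 0 then 1 else 2 * binom_sum (d - 1) ((1 + c) / 2) / (1 + c) ^ d)"

lemma laplace_value_nonneg: "c \<ge> 0 \<Longrightarrow> laplace_value d c \<ge> 0"
  by (auto simp: laplace_value_def binom_sum_def intro!: divide_nonneg_nonneg sum_nonneg)

text \<open>With z = (1 + c) / 2 one has c = 2 z - 1 and 1 - c^2 = 4 z (1 - z), so for d >= 1 this
  is \<open>binom_sum_Suc\<close> divided by 1 - z. The value at 1 supplies the central binomial
  term through \<open>binom_sum_1\<close>.\<close>

lemma laplace_value_Suc: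
  assumes c: "c > 0" "c \<noteq> 1"
  shows "laplace_value (Suc d) c = 2 * (laplace_value d c - c * laplace_value d 1) / (1 - c\<^sup>2)"
proof -
  have c2: "1 - c\<^sup>2 = (1 - c) * (1 + c)" by (simp add: power2_eq_square algebra_simps)
  have nz: "1 - c \<noteq> 0" "1 + c \<noteq> 0" using c by auto
  show ?thesis
  proof (cases d)
    case 0
    then show ?thesis using nz unfolding c2 by (simp add: laplace_value_def binom_sum_def divide_simps)
  next
    case (Suc n)
    define z where "z = (1 + c) / 2"
    have z: "1 + c = 2 * z" "c = 2 * z - 1" "1 - c = 2 * (1 - z)" "1 - z \<noteq> 0" "z \<noteq> 0"
      using nz by (auto simp: z_def field_simps)
    have v: "laplace_value (Suc k) c = 2 * binom_sum k z / (2 * z) ^ Suc k" for k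
      using z(1) by (simp add: laplace_value_def)
    have v1: "laplace_value (Suc n) 1 = 2 * real ((2 * n + 1) choose (n + 1)) / 2 ^ Suc n"
      by (simp only: laplace_value_def flip: binom_sum_1) simp
    have "binom_sum (Suc n) z = (binom_sum n z - (2 * z - 1) * z ^ (n + 1) * real ((2 * n + 1) choose (n + 1))) / (1 - z)"
      using binom_sum_Suc[of z n] z(4) by (simp add: field_simps)
    then show ?thesis
      unfolding Suc v v1 c2 unfolding z(1,3) unfolding z(2) using z(4,5)
      by (simp add: power_mult_distrib divide_simps) (simp add: algebra_simps)
  qed
qed

lemma continuous_laplace_value: "isCont (laplace_value d) 1"
  unfolding laplace_value_def binom_sum_def by (cases d) (auto intro!: continuous_intros)

text \<open>The new coordinate is integrated first; the old ones enter its integral only through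
  their sum s and the factor exp of minus their absolute sum, so the one-dimensional kernel
  applies.\<close>

lemma laplace_integral_insert:
  assumes I: "finite I" "i \<notin> I" and c: "c > 0" "c \<noteq> 1"
  shows "laplace_integral (insert i I) c =
    (\<integral>\<^sup>+x. ennreal (exp (- (\<Sum>i\<in>I. \<bar>x i\<bar>)) * (2 * (exp (- c * \<bar>\<Sum>i\<in>I. x i\<bar>) - c * exp (- \<bar>\<Sum>i\<in>I. x i\<bar>)) / (1 - c\<^sup>2)))
       \<partial>Pi\<^sub>M I (\<lambda>_. lborel))"
proof -
  interpret product_sigma_finite "\<lambda>_::'a. lborel :: real measure" by standard
  have "laplace_integral (insert i I) c = (\<integral>\<^sup>+x. \<integral>\<^sup>+y. ennreal (exp (- ((\<Sum>k\<in>insert i I. \<bar>(x(i := y)) k\<bar>)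
       + c * \<bar>\<Sum>k\<in>insert i I. (x(i := y)) k\<bar>))) \<partial>lborel \<partial>Pi\<^sub>M I (\<lambda>_. lborel))"
    unfolding laplace_integral_def using I by (subst product_nn_integral_insert) auto
  also have "\<dots> = (\<integral>\<^sup>+x. \<integral>\<^sup>+y. ennreal (exp (- (\<Sum>k\<in>I. \<bar>x k\<bar>))) *
      ennreal (exp (- (\<bar>y\<bar> + c * \<bar>(\<Sum>k\<in>I. x k) + y\<bar>))) \<partial>lborel \<partial>Pi\<^sub>M I (\<lambda>_. lborel))"
  proof (intro nn_integral_cong)
    fix x :: "'a \<Rightarrow> real" and y :: real
    have "(\<Sum>k\<in>I. \<bar>(x(i := y)) k\<bar>) = (\<Sum>k\<in>I. \<bar>x k\<bar>)" "(\<Sum>k\<in>I. (x(i := y)) k) = (\<Sum>k\<in>I. x k)"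
      using I by (auto intro!: sum.cong)
    then show "ennreal (exp (- ((\<Sum>k\<in>insert i I. \<bar>(x(i := y)) k\<bar>) + c * \<bar>\<Sum>k\<in>insert i I. (x(i := y)) k\<bar>)))
      = ennreal (exp (- (\<Sum>k\<in>I. \<bar>x k\<bar>))) * ennreal (exp (- (\<bar>y\<bar> + c * \<bar>(\<Sum>k\<in>I. x k) + y\<bar>)))"
      using I by (simp add: ennreal_mult[symmetric] exp_add[symmetric] add_ac)
  qed
  also have "\<dots> = (\<integral>\<^sup>+x. ennreal (exp (- (\<Sum>k\<in>I. \<bar>x k\<bar>))) *
      ennreal (2 * (exp (- c * \<bar>\<Sum>i\<in>I. x i\<bar>) - c * exp (- \<bar>\<Sum>i\<in>I. x i\<bar>)) / (1 - c\<^sup>2)) \<partial>Pi\<^sub>M I (\<lambda>_. lborel))"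
    by (subst nn_integral_cmult) (simp, simp only: nn_integral_laplace_kernel[OF c])
  finally show ?thesis by (simp only: ennreal_mult' exp_ge_zero)
qed

text \<open>Multiplied by the remaining factor, the two exponentials of the kernel become the
  integrands for the parameters c and 1. Linearity then gives exactly the recursion of
  \<open>laplace_value_Suc\<close>.\<close>

lemma laplace_integral_insert_value:
  assumes I: "finite I" "i \<notin> I" and c: "c > 0" "c \<noteq> 1"
    and IH: "\<And>c. c > 0 \<Longrightarrow> laplace_integral I c = ennreal (laplace_value d c)"
  shows "laplace_integral (insert i I) c = ennreal (laplace_value (Suc d) c)"
proof -
  let ?M = "Pi\<^sub>M I (\<lambda>_. lborel :: real measure)"
  define E where "E c x = exp (- ((\<Sum>i\<in>I. \<bar>x i\<bar>) + c * \<bar>\<Sum>i\<in>I. x i\<bar>))" for c :: real and x :: "'a \<Rightarrow> real"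
  have meas: "E c \<in> borel_measurable ?M" for c unfolding E_def by measurable
  have hb: "has_bochner_integral ?M (E c) (laplace_value d c)" if "c > 0" for c
    using IH[OF that] meas laplace_value_nonneg[of c d] that
    by (intro has_bochner_integral_nn_integral) (auto simp: laplace_integral_def E_def)
  \<comment> \<open>The recursion contains a difference, so linearity is applied to real Bochner
    integrals; nonnegativity of the combined integrand leads back to \<open>ennreal\<close>.\<close>
  have "has_bochner_integral ?M (\<lambda>x. 2 * (E c x - c * E 1 x) / (1 - c\<^sup>2))
      (2 * (laplace_value d c - c * laplace_value d 1) / (1 - c\<^sup>2))"
    by (intro has_bochner_integral_divide_zero has_bochner_integral_mult_right has_bochner_integral_diff hb) (use c in auto)
  then have hb2: "has_bochner_integral ?M (\<lambda>x. 2 * (E c x - c * E 1 x) / (1 - c\<^sup>2)) (laplace_value (Suc d) c)"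
    by (simp add: laplace_value_Suc[OF c])
  have nonneg: "2 * (E c x - c * E 1 x) / (1 - c\<^sup>2) \<ge> 0" for x
  proof -
    define s where "s = \<bar>\<Sum>i\<in>I. x i\<bar>"
    have s: "s \<ge> 0" by (simp add: s_def)
    have "2 * (E c x - c * E 1 x) / (1 - c\<^sup>2)
        = exp (- (\<Sum>i\<in>I. \<bar>x i\<bar>)) * (2 * (exp (- c * s) - c * exp (- s)) / (1 - c\<^sup>2))"
      by (simp add: E_def s_def exp_add exp_diff exp_minus field_simps)
    also have "\<dots> \<ge> 0"
    proof -
      \<comment> \<open>The second factor is nonnegative for c < 1 and nonpositive for c > 1, just
        like 1 - c^2.\<close>
      have eq: "exp (- c * s) - c * exp (- s) = exp (- s) * (exp ((1 - c) * s) - c)"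
        by (simp add: right_diff_distrib exp_add[symmetric] algebra_simps)
      have "(exp (- c * s) - c * exp (- s)) / (1 - c\<^sup>2) \<ge> 0"
      proof (cases "c < 1")
        case True
        then have "exp ((1 - c) * s) \<ge> c" using s by (intro order_trans[of c 1 "exp _"]) simp_all
        moreover have "c\<^sup>2 < 1" using True c by (simp add: power_less_one_iff abs_square_less_1)
        ultimately show ?thesis unfolding eq using True by (intro divide_nonneg_nonneg mult_nonneg_nonneg) auto
      next
        case False
        then have "exp ((1 - c) * s) \<le> c" using s by (intro order_trans[of "exp _" 1 c]) (simp_all add: mult_nonpos_nonneg)
        moreover have "c\<^sup>2 \<ge> 1" using False by simp
        ultimately show ?thesis unfolding eq using False
          by (intro divide_nonpos_nonpos mult_nonneg_nonpos) auto
      qed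
      then show ?thesis
        unfolding times_divide_eq_right[symmetric] by (intro mult_nonneg_nonneg) simp_all
    qed
    finally show ?thesis .
  qed
  have "laplace_integral (insert i I) c = (\<integral>\<^sup>+x. ennreal (2 * (E c x - c * E 1 x) / (1 - c\<^sup>2)) \<partial>?M)"
    unfolding laplace_integral_insert[OF I c]
    by (intro nn_integral_cong arg_cong[where f = ennreal])
       (simp add: E_def exp_add exp_diff exp_minus field_simps)
  also have "\<dots> = ennreal (laplace_value (Suc d) c)"
    using hb2 nonneg by (subst nn_integral_eq_integral) (auto simp: has_bochner_integral_iff)
  finally show ?thesis .
qed

lemma laplace_integral_antimono: "c \<le> c' \<Longrightarrow> laplace_integral I c' \<le> laplace_integral I c"
  unfolding laplace_integral_def
  by (intro nn_integral_mono) (auto intro!: ennreal_leI mult_right_mono)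

text \<open>Indexing by a finite set instead of a type makes induction on the dimension possible.
  The parameter stays general because one step uses the values at c and at 1.\<close>

lemma laplace_integral_eq:
  assumes "finite I" "c > 0"
  shows "laplace_integral I c = ennreal (laplace_value (card I) c)"
  using assms
proof (induction I arbitrary: c rule: finite_induct)
  case empty
  then show ?case by (simp add: laplace_integral_def laplace_value_def PiM_empty nn_integral_count_space_finite)
next
  case (insert i I)
  let ?d = "Suc (card I)"
  have ne: "laplace_integral (insert i I) c = ennreal (laplace_value ?d c)" if "c > 0" "c \<noteq> 1" for c
    by (rule laplace_integral_insert_value[OF insert.hyps that insert.IH])
  (* The recursion has a pole at 1; the value there is squeezed between the neighbouring ones. *)
  have "laplace_integral (insert i I) 1 \<le> laplace_integral (insert i I) (1/2)"
    by (rule laplace_integral_antimono) simp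
  then have "laplace_integral (insert i I) 1 < top"
    by (subst (asm) ne) (auto intro: le_less_trans)
  then obtain r where r: "r \<ge> 0" "laplace_integral (insert i I) 1 = ennreal r"
    by (metis ennreal_cases less_irrefl top.not_eq_extremum)
  have lim: "(laplace_value ?d \<longlongrightarrow> laplace_value ?d 1) (at 1)"
    using continuous_laplace_value[of ?d] by (simp add: isCont_def)
  have "r \<le> laplace_value ?d 1"
  proof (rule tendsto_lowerbound)
    show "(laplace_value ?d \<longlongrightarrow> laplace_value ?d 1) (at_left 1)"
      using lim by (simp add: filterlim_at_split)
    have "\<forall>\<^sub>F c::real in at_left 1. c \<in> {0<..<1}" by (rule eventually_at_left_real) simp
    then show "\<forall>\<^sub>F c in at_left 1. r \<le> laplace_value ?d c"
    proof eventually_elim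
      case (elim c)
      then show ?case
        using laplace_integral_antimono[of c 1 "insert i I"] ne[of c] laplace_value_nonneg[of c ?d]
        by (auto simp: r)
    qed
  qed simp
  moreover have "laplace_value ?d 1 \<le> r"
  proof (rule tendsto_upperbound)
    show "(laplace_value ?d \<longlongrightarrow> laplace_value ?d 1) (at_right 1)"
      using lim by (simp add: filterlim_at_split)
    have "\<forall>\<^sub>F c::real in at_right 1. c \<in> {1<..<2}" by (rule eventually_at_right_real) simp
    then show "\<forall>\<^sub>F c in at_right 1. laplace_value ?d c \<le> r"
    proof eventually_elim
      case (elim c)
      then show ?case
        using laplace_integral_antimono[of 1 c "insert i I"] ne[of c] r by auto
    qed
  qed simp
  ultimately have "laplace_integral (insert i I) 1 = ennreal (laplace_value ?d 1)"
    using r by simp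
  then show ?case using ne[of c] insert by (cases "c = 1") auto
qed

section \<open>Lebesgue measure on vectors and volumes of gauge balls\<close>

lemma measurable_vec_lambda_PiM:
  "(\<lambda>f. \<chi> i. f i) \<in> Pi\<^sub>M UNIV (\<lambda>_::'n::finite. lborel :: real measure) \<rightarrow>\<^sub>M borel"
  by (subst borel_measurable_euclidean_space) (auto simp: Basis_vec_def inner_axis)

text \<open>\<open>lborel\<close> is determined by its values on boxes, and the preimage of a box is
  a product of intervals.\<close>

lemma lborel_vec_eq:
  "(lborel :: (real ^ 'n) measure) = distr (Pi\<^sub>M UNIV (\<lambda>_. lborel)) borel (\<lambda>f. \<chi> i. f i)"
proof (rule lborel_eqI)
  interpret product_sigma_finite "\<lambda>_::'n. lborel :: real measure" by standard
  fix l u :: "real ^ 'n"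
  assume le: "\<And>b. b \<in> Basis \<Longrightarrow> l \<bullet> b \<le> u \<bullet> b"
  have le': "l $ i \<le> u $ i" for i
    using le[of "axis i 1"] by (auto simp: Basis_vec_def inner_axis)
  have "emeasure (distr (Pi\<^sub>M UNIV (\<lambda>_. lborel)) borel (\<lambda>f. \<chi> i. f i)) (box l u)
      = emeasure (Pi\<^sub>M UNIV (\<lambda>_. lborel)) (\<Pi>\<^sub>E i\<in>UNIV. {l $ i<..<u $ i})"
    by (subst emeasure_distr[OF measurable_vec_lambda_PiM]) (auto intro!: arg_cong2[where f = emeasure] simp: mem_box_cart space_PiM PiE_UNIV_domain Pi_iff)
  also have "\<dots> = ennreal (\<Prod>i\<in>UNIV. u $ i - l $ i)"
    by (subst emeasure_PiM) (use le' in \<open>auto simp: prod_ennreal\<close>)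
  also have "(\<Prod>i\<in>UNIV. u $ i - l $ i) = (\<Prod>b\<in>Basis. (u - l) \<bullet> b)"
    by (subst Basis_vec_def) (simp add: prod.UNION_disjoint axis_eq_axis inner_axis)
  finally show "emeasure (distr (Pi\<^sub>M UNIV (\<lambda>_. lborel)) borel (\<lambda>f. \<chi> i. f i)) (box l u)
      = ennreal (\<Prod>b\<in>Basis. (u - l) \<bullet> b)" .
qed simp

lemma nn_integral_lborel_vec:
  fixes f :: "real ^ 'n \<Rightarrow> ennreal"
  assumes "f \<in> borel_measurable borel"
  shows "(\<integral>\<^sup>+x. f x \<partial>lborel) = (\<integral>\<^sup>+x. f (\<chi> i. x i) \<partial>Pi\<^sub>M UNIV (\<lambda>_. lborel))"
  using assms by (subst lborel_vec_eq) (simp add: nn_integral_distr measurable_vec_lambda_PiM)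

lemma emeasure_lborel_scaleR_vimage:
  fixes A :: "'a::euclidean_space set"
  assumes "r > 0" and A: "A \<in> sets borel"
  shows "emeasure lborel A = ennreal (r ^ DIM('a)) * emeasure lborel {x. r *\<^sub>R x \<in> A}"
proof -
  have "emeasure lborel A
      = emeasure (density (distr lborel borel (\<lambda>x. 0 + r *\<^sub>R x)) (\<lambda>_. ennreal (\<bar>r\<bar> ^ DIM('a)))) A"
    using lborel_affine[of r "0::'a"] assms by simp
  also have "\<dots> = ennreal (r ^ DIM('a)) * emeasure (distr lborel borel (\<lambda>x. r *\<^sub>R x)) A"
    using assms by (subst emeasure_density) (auto simp: nn_integral_cmult_indicator)
  also have "emeasure (distr lborel borel (\<lambda>x. r *\<^sub>R x)) A = emeasure lborel {x. r *\<^sub>R x \<in> A}"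
    using A by (subst emeasure_distr) (auto simp: vimage_def)
  finally show ?thesis .
qed

text \<open>Layer cake: exp (- N x) is the integral of exp (- r) over r >= N x. After exchanging the
  integrals, the sublevel set of N at r > 0 is the unit ball scaled by r, and the integral of r^d
  exp (- r) over r >= 0 is d!.\<close>

lemma nn_integral_exp_minus_gauge:
  fixes N :: "'a::euclidean_space \<Rightarrow> real"
  assumes [measurable]: "N \<in> borel_measurable borel"
    and nonneg: "\<And>x. N x \<ge> 0"
    and hom: "\<And>r x. r > 0 \<Longrightarrow> N (r *\<^sub>R x) = r * N x"
  shows "(\<integral>\<^sup>+x. ennreal (exp (- N x)) \<partial>lborel) = ennreal (fact DIM('a)) * emeasure lborel {x. N x \<le> 1}"
proof -
  have sub: "emeasure lborel {x. N x \<le> r} = ennreal (r ^ DIM('a)) * emeasure lborel {x. N x \<le> 1}"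
    if "r > 0" for r
    using that by (subst emeasure_lborel_scaleR_vimage[OF that]) (auto simp: hom)
  have "(\<integral>\<^sup>+x. ennreal (exp (- N x)) \<partial>lborel)
      = (\<integral>\<^sup>+x. \<integral>\<^sup>+r. ennreal (exp (- r)) * indicator {N x..} r \<partial>lborel \<partial>lborel)"
    using nn_integral_exp_atLeast[of 1 0] by simp
  also have "\<dots> = (\<integral>\<^sup>+r. \<integral>\<^sup>+x. ennreal (exp (- r)) * indicator {N x..} r \<partial>lborel \<partial>lborel)"
    by (rule lborel_pair.Fubini'[symmetric]) (measurable, unfold atLeast_iff, measurable)
  also have "\<dots> = (\<integral>\<^sup>+r. \<integral>\<^sup>+x. ennreal (exp (- r)) * indicator {x. N x \<le> r} x \<partial>lborel \<partial>lborel)"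
    by (intro nn_integral_cong) (auto simp: indicator_def)
  also have "\<dots> = (\<integral>\<^sup>+r. ennreal (exp (- r)) * emeasure lborel {x. N x \<le> r} \<partial>lborel)"
    by (intro nn_integral_cong nn_integral_cmult_indicator) measurable
  also have "\<dots> = (\<integral>\<^sup>+r. ennreal (r ^ DIM('a) * exp (- r)) * indicator {0..} r
      * emeasure lborel {x. N x \<le> 1} \<partial>lborel)"
  proof (rule nn_integral_cong_AE)
    show "AE r in lborel. ennreal (exp (- r)) * emeasure lborel {x. N x \<le> r}
        = ennreal (r ^ DIM('a) * exp (- r)) * indicator {0..} r * emeasure lborel {x. N x \<le> 1}"
      \<comment> \<open>Scaling covers r > 0 and for r < 0 the sublevel set is empty; the point r =
        0 is discarded as a null set.\<close>
      using AE_lborel_singleton[of 0]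
    proof eventually_elim
      case (elim r)
      show ?case
      proof (cases "r > 0")
        case True
        then show ?thesis by (subst sub) (simp_all add: ennreal_mult mult_ac)
      next
        case False
        then have "r < 0" using elim by simp
        then have "{x. N x \<le> r} = {}" using nonneg by (auto simp: not_le intro: less_le_trans)
        then show ?thesis using \<open>r < 0\<close> by simp
      qed
    qed
  qed
  also have "\<dots> = ennreal (fact DIM('a)) * emeasure lborel {x. N x \<le> 1}"
    by (subst nn_integral_multc) (simp_all add: nn_intergal_power_times_exp_Ici)
  finally show ?thesis .
qed

lemma emeasure_laplace_ball:
  assumes c: "c > 0"
  shows "ennreal (fact CARD('n)) *
      emeasure lborel {x :: real ^ 'n. (\<Sum>i\<in>UNIV. \<bar>x $ i\<bar>) + c * \<bar>\<Sum>i\<in>UNIV. x $ i\<bar> \<le> 1}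
    = ennreal (laplace_value CARD('n) c)"
proof -
  let ?N = "\<lambda>x :: real ^ 'n. (\<Sum>i\<in>UNIV. \<bar>x $ i\<bar>) + c * \<bar>\<Sum>i\<in>UNIV. x $ i\<bar>"
  have meas: "?N \<in> borel_measurable borel"
    by (intro borel_measurable_continuous_onI continuous_intros)
  have "(\<integral>\<^sup>+x. ennreal (exp (- ?N x)) \<partial>lborel) = laplace_integral (UNIV :: 'n set) c"
    using meas by (subst nn_integral_lborel_vec) (simp_all add: laplace_integral_def)
  moreover have "(\<integral>\<^sup>+x. ennreal (exp (- ?N x)) \<partial>lborel)
      = ennreal (fact DIM(real ^ 'n)) * emeasure lborel {x. ?N x \<le> 1}"
    using c by (intro nn_integral_exp_minus_gauge meas)
       (auto simp: sum_nonneg abs_mult sum_distrib_left[symmetric] algebra_simps)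
  ultimately show ?thesis
    using laplace_integral_eq[of "UNIV :: 'n set" c] c by simp
qed

section \<open>Volume of the isocanted cube\<close>

lemma emeasure_lborel_vec:
  fixes A :: "(real ^ 'n) set"
  assumes "A \<in> sets borel"
  shows "emeasure lborel A = (\<integral>\<^sup>+x. indicator A (\<chi> i. x i) \<partial>Pi\<^sub>M UNIV (\<lambda>_. lborel))"
proof -
  have "emeasure lborel A = (\<integral>\<^sup>+x. indicator A x \<partial>lborel)" using assms by simp
  then show ?thesis using nn_integral_lborel_vec[OF borel_measurable_indicator[OF assms]] by (rule trans)
qed

text \<open>The part of the isocanted cube below the corner cube [a - l/2, l/2]^d in which
  coordinate j is the strict minimum. Strictness makes the parts for different j disjoint and loses
  only ties.\<close>

definition least_coord_slab :: "real \<Rightarrow> real \<Rightarrow> 'n \<Rightarrow> (real ^ 'n) set" where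
  "least_coord_slab l a j = {x. - (l / 2) \<le> x $ j \<and> x $ j < a - l / 2 \<and>
     (\<forall>k. k \<noteq> j \<longrightarrow> x $ j < x $ k \<and> x $ k \<le> x $ j + (l - a))}"

lemma borel_least_coord_slab: "least_coord_slab l a (j :: 'n::finite) \<in> sets borel"
proof -
  \<comment> \<open>The weak inequalities define a closed set and the strict ones an open
    set.\<close>
  have eq: "least_coord_slab l a j
      = {x. - (l / 2) \<le> x $ j \<and> (\<forall>k. k \<noteq> j \<longrightarrow> x $ k \<le> x $ j + (l - a))}
        \<inter> ({x. x $ j < a - l / 2} \<inter> (\<Inter>k\<in>UNIV - {j}. {x. x $ j < x $ k}))"
    by (auto simp: least_coord_slab_def)
  show ?thesis
    unfolding eq
    by (intro sets.Int borel_closed borel_open closed_Collect_conj closed_Collect_all closed_Collect_imp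
        closed_Collect_le open_Collect_const open_Int open_INT ballI open_Collect_less continuous_intros finite)
qed

text \<open>Once the least coordinate t is fixed, the others range independently over intervals of
  length l - a, and t itself ranges over an interval of length a.\<close>

lemma emeasure_least_coord_slab:
  assumes "0 < a" "a < l"
  shows "emeasure lborel (least_coord_slab l a (j :: 'n::finite)) = ennreal (a * (l - a) ^ (CARD('n) - 1))"
proof -
  interpret product_sigma_finite "\<lambda>_::'n. lborel :: real measure" by standard
  let ?I = "UNIV - {j}" and ?S = "least_coord_slab l a j"
  have UNIV: "UNIV = insert j ?I" by auto
  have meas: "(\<lambda>x. indicator ?S (\<chi> i. x i) :: ennreal) \<in> borel_measurable (Pi\<^sub>M UNIV (\<lambda>_. lborel))"
    using borel_least_coord_slab measurable_vec_lambda_PiM by measurable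
  have "emeasure lborel ?S = (\<integral>\<^sup>+x. indicator ?S (\<chi> i. x i) \<partial>Pi\<^sub>M (insert j ?I) (\<lambda>_. lborel))"
    using emeasure_lborel_vec[OF borel_least_coord_slab] UNIV by simp
  also have "\<dots> = (\<integral>\<^sup>+t. \<integral>\<^sup>+x. indicator ?S (\<chi> i. (x(j := t)) i) \<partial>Pi\<^sub>M ?I (\<lambda>_. lborel) \<partial>lborel)"
    using meas UNIV by (subst product_nn_integral_insert_rev) simp_all
  also have "\<dots> = (\<integral>\<^sup>+t. \<integral>\<^sup>+x. indicator {- (l / 2)..<a - l / 2} t * (\<Prod>k\<in>?I. indicator {t<..t + (l - a)} (x k))
      \<partial>Pi\<^sub>M ?I (\<lambda>_. lborel) \<partial>lborel)"
  proof (intro nn_integral_cong)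
    fix x :: "'n \<Rightarrow> real" and t :: real
    have "(\<Prod>k\<in>?I. indicator {t<..t + (l - a)} (x k)) = (if \<forall>k\<in>?I. x k \<in> {t<..t + (l - a)} then 1 else 0 :: ennreal)"
      by (auto simp: indicator_def intro!: prod.neutral prod_zero)
    then show "indicator ?S (\<chi> i. (x(j := t)) i)
        = indicator {- (l / 2)..<a - l / 2} t * (\<Prod>k\<in>?I. indicator {t<..t + (l - a)} (x k) :: ennreal)"
      by (auto simp: least_coord_slab_def indicator_def)
  qed
  also have "\<dots> = (\<integral>\<^sup>+t. indicator {- (l / 2)..<a - l / 2} t * (\<Prod>k\<in>?I. emeasure lborel {t<..t + (l - a)}) \<partial>lborel)"
  proof (rule nn_integral_cong)
    fix t :: real
    have "(\<integral>\<^sup>+x. (\<Prod>k\<in>?I. indicator {t<..t + (l - a)} (x k)) \<partial>Pi\<^sub>M ?I (\<lambda>_. lborel))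
        = (\<Prod>k\<in>?I. emeasure lborel {t<..t + (l - a)})"
      by (subst product_nn_integral_prod) simp_all
    then show "(\<integral>\<^sup>+x. indicator {- (l / 2)..<a - l / 2} t * (\<Prod>k\<in>?I. indicator {t<..t + (l - a)} (x k))
          \<partial>Pi\<^sub>M ?I (\<lambda>_. lborel))
        = indicator {- (l / 2)..<a - l / 2} t * (\<Prod>k\<in>?I. emeasure lborel {t<..t + (l - a)})"
      by (subst nn_integral_cmult) simp_all
  qed
  also have "\<dots> = (\<integral>\<^sup>+t. ennreal ((l - a) ^ (CARD('n) - 1)) * indicator {- (l / 2)..<a - l / 2} t \<partial>lborel)"
    using assms by (simp add: ennreal_power mult.commute)
  also have "\<dots> = ennreal ((l - a) ^ (CARD('n) - 1)) * ennreal a"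
    using assms by (subst nn_integral_cmult_indicator) simp_all
  finally show ?thesis using assms by (simp add: ennreal_mult'' mult.commute)
qed

lemma compact_isocanted_cube: "compact (isocanted_cube l a :: (real ^ 'n::finite) set)"
proof -
  have "isocanted_cube l a \<subseteq> cbox (\<chi> j. - (l / 2)) (\<chi> j. l / 2)"
    by (auto simp: isocanted_cube_def mem_box_cart)
  then have "bounded (isocanted_cube l a)" by (rule bounded_subset[OF bounded_cbox])
  moreover have "closed (isocanted_cube l a)"
    unfolding isocanted_cube_def
    by (intro closed_Collect_conj closed_Collect_all closed_Collect_imp closed_Collect_le
        open_Collect_const continuous_intros)
  ultimately show ?thesis by (simp add: compact_eq_bounded_closed)
qed

text \<open>The corner cube C of side l - a and the d slabs are disjoint subsets, of total volume (l
  - a)^d + d a (l - a)^(d-1). A lower bound suffices, so no covering argument is made.\<close>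

lemma measure_isocanted_cube_ge:
  assumes a: "0 < a" "a < l"
  shows "(l - a) ^ CARD('n) * (1 + real CARD('n) * (a / (l - a)))
    \<le> measure lebesgue (isocanted_cube l a :: (real ^ 'n) set)"
proof -
  let ?K = "isocanted_cube l a :: (real ^ 'n) set" and ?S = "least_coord_slab l a :: 'n \<Rightarrow> _"
  have borel_K: "?K \<in> sets borel" by (rule borel_compact[OF compact_isocanted_cube])
  define C :: "(real ^ 'n) set" where "C = cbox (\<chi> i. a - l / 2) (\<chi> i. l / 2)"
  have C: "emeasure lborel C = ennreal ((l - a) ^ CARD('n))"
  proof -
    have "C \<noteq> {}" using a by (auto simp: C_def interval_eq_empty_cart)
    then have "measure lborel C = (l - a) ^ CARD('n)"
      unfolding C_def by (subst content_cbox_cart) simp_all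
    then show ?thesis using emeasure_eq_measure2[OF fmeasurable_cbox] unfolding C_def by metis
  qed
  have "C \<subseteq> ?K"
  proof
    fix x assume "x \<in> C"
    then have x: "a - l / 2 \<le> x $ i" "x $ i \<le> l / 2" for i by (auto simp: C_def mem_box_cart)
    have "a - l \<le> x $ i - x $ k" "x $ i - x $ k \<le> l - a" for i k
      using x[of i] x[of k] by linarith+
    moreover have "- (l / 2) \<le> x $ i" for i using x(1)[of i] a by linarith
    ultimately show "x \<in> ?K" using x by (auto simp: isocanted_cube_def)
  qed
  moreover have "?S j \<subseteq> ?K" for j
  proof
    fix x assume "x \<in> ?S j"
    then have x: "- (l / 2) \<le> x $ j" "x $ j < a - l / 2"
        "x $ j \<le> x $ k" "x $ k \<le> x $ j + (l - a)" for k
      using a by (cases "k = j"; auto simp: least_coord_slab_def)+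
    show "x \<in> ?K"
      unfolding isocanted_cube_def
    proof (intro CollectI conjI allI impI)
      fix i k
      show "- (l / 2) \<le> x $ i" using x(1) x(3)[of i] by linarith
      show "x $ i \<le> l / 2" using x(2) x(4)[of i] by (simp add: field_simps)
      show "a - l \<le> x $ i - x $ k" using x(3)[of i] x(4)[of k] by linarith
      show "x $ i - x $ k \<le> l - a" using x(3)[of k] x(4)[of i] by linarith
    qed
  qed
  ultimately have sub: "C \<union> (\<Union>j. ?S j) \<subseteq> ?K" by auto
  have "C \<inter> ?S j = {}" for j
  proof -
    have "a - l / 2 \<le> x $ j" if "x \<in> C" for x using that by (auto simp: C_def mem_box_cart)
    then show ?thesis by (auto simp: least_coord_slab_def not_less[symmetric])
  qed
  then have "C \<inter> (\<Union>j. ?S j) = {}" by blast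
  moreover have disj: "disjoint_family_on ?S UNIV"
    unfolding disjoint_family_on_def
  proof (intro ballI impI)
    fix i j :: 'n assume "i \<noteq> j"
    then have "x $ i < x $ j" if "x \<in> ?S i" for x using that by (auto simp: least_coord_slab_def)
    moreover have "x $ j < x $ i" if "x \<in> ?S j" for x
      using that \<open>i \<noteq> j\<close> by (auto simp: least_coord_slab_def)
    ultimately show "?S i \<inter> ?S j = {}" using less_asym by blast
  qed
  ultimately have "emeasure lborel (C \<union> (\<Union>j. ?S j)) = emeasure lborel C + (\<Sum>j\<in>UNIV. emeasure lborel (?S j))"
    using borel_least_coord_slab
    by (subst plus_emeasure[symmetric])
       (auto simp: C_def image_subset_iff intro!: sum_emeasure[symmetric] sets.finite_UN)
  also have "\<dots> = ennreal ((l - a) ^ CARD('n) + real CARD('n) * (a * (l - a) ^ (CARD('n) - 1)))"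
    using a by (simp add: C emeasure_least_coord_slab ennreal_of_nat_eq_real_of_nat flip: ennreal_mult' ennreal_plus)
  also have "(l - a) ^ CARD('n) + real CARD('n) * (a * (l - a) ^ (CARD('n) - 1))
      = (l - a) ^ CARD('n) * (1 + real CARD('n) * (a / (l - a)))"
    using a by (cases "CARD('n)") (auto simp: field_simps)
  finally have "ennreal ((l - a) ^ CARD('n) * (1 + real CARD('n) * (a / (l - a)))) \<le> emeasure lborel ?K"
    using emeasure_mono[OF sub, of lborel] borel_K by simp
  also have "\<dots> = emeasure lebesgue ?K"
    using borel_K by simp
  also have "\<dots> = ennreal (measure lebesgue ?K)"
    using lmeasurable_compact[OF compact_isocanted_cube] by (intro emeasure_eq_measure2) auto
  finally show ?thesis by (simp add: ennreal_le_iff)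
qed

section \<open>The polar dual and its volume\<close>

lemma polar_dual_isocanted_cube:
  assumes a: "0 < a" "a < l"
  shows "polar_dual (isocanted_cube l a :: (real ^ 'n) set)
    = {x. (l - a) / 2 * (\<Sum>i\<in>UNIV. \<bar>x $ i\<bar>) + a / 2 * \<bar>\<Sum>i\<in>UNIV. x $ i\<bar> \<le> 1}"
proof (intro subset_antisym subsetI)
  fix x :: "real ^ 'n" assume x: "x \<in> polar_dual (isocanted_cube l a)"
  \<comment> \<open>The point of the isocanted cube at which x attains its maximum: the signs of the
    coordinates choose a vertex of the small cube (0 where x vanishes), the sign of their sum an end
    of the diagonal segment. Then x \<bullet> y is the norm of x in the claim.\<close>
  define y :: "real ^ 'n" where "y = (\<chi> i. (l - a) / 2 * sgn (x $ i) + a / 2 * sgn (\<Sum>i\<in>UNIV. x $ i))"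
  have sgn: "(l - a) / 2 * sgn s \<le> (l - a) / 2" "- ((l - a) / 2) \<le> (l - a) / 2 * sgn s"
    "a / 2 * sgn s \<le> a / 2" "- (a / 2) \<le> a / 2 * sgn s" for s
    using a by (auto simp: sgn_if field_simps)
  have "y \<in> isocanted_cube l a"
    unfolding isocanted_cube_def y_def
  proof (intro CollectI conjI allI impI; simp only: vec_lambda_beta)
    fix j k
    show "- (l / 2) \<le> (l - a) / 2 * sgn (x $ j) + a / 2 * sgn (\<Sum>i\<in>UNIV. x $ i)"
      using sgn(2)[of "x $ j"] sgn(4)[of "\<Sum>i\<in>UNIV. x $ i"] unfolding diff_divide_distrib by linarith
    show "(l - a) / 2 * sgn (x $ j) + a / 2 * sgn (\<Sum>i\<in>UNIV. x $ i) \<le> l / 2"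
      using sgn(1)[of "x $ j"] sgn(3)[of "\<Sum>i\<in>UNIV. x $ i"] unfolding diff_divide_distrib by linarith
    show "a - l \<le> (l - a) / 2 * sgn (x $ j) + a / 2 * sgn (\<Sum>i\<in>UNIV. x $ i)
        - ((l - a) / 2 * sgn (x $ k) + a / 2 * sgn (\<Sum>i\<in>UNIV. x $ i))"
      using sgn(2)[of "x $ j"] sgn(1)[of "x $ k"] unfolding diff_divide_distrib by linarith
    show "(l - a) / 2 * sgn (x $ j) + a / 2 * sgn (\<Sum>i\<in>UNIV. x $ i)
        - ((l - a) / 2 * sgn (x $ k) + a / 2 * sgn (\<Sum>i\<in>UNIV. x $ i)) \<le> l - a"
      using sgn(1)[of "x $ j"] sgn(2)[of "x $ k"] unfolding diff_divide_distrib by linarith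
  qed
  then have "x \<bullet> y \<le> 1" using x by (auto simp: polar_dual_def)
  also have "x \<bullet> y = (\<Sum>i\<in>UNIV. (l - a) / 2 * \<bar>x $ i\<bar> + x $ i * (a / 2 * sgn (\<Sum>i\<in>UNIV. x $ i)))"
    unfolding inner_vec_def y_def by (intro sum.cong) (simp_all add: abs_sgn algebra_simps)
  also have "\<dots> = (l - a) / 2 * (\<Sum>i\<in>UNIV. \<bar>x $ i\<bar>) + a / 2 * \<bar>\<Sum>i\<in>UNIV. x $ i\<bar>"
    unfolding sum.distrib sum_distrib_left[symmetric] sum_distrib_right[symmetric]
    by (simp only: abs_sgn[of "\<Sum>i\<in>UNIV. x $ i"] mult_ac)
  finally show "x \<in> {x. (l - a) / 2 * (\<Sum>i\<in>UNIV. \<bar>x $ i\<bar>) + a / 2 * \<bar>\<Sum>i\<in>UNIV. x $ i\<bar> \<le> 1}" by simp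
next
  fix x :: "real ^ 'n"
  assume "x \<in> {x. (l - a) / 2 * (\<Sum>i\<in>UNIV. \<bar>x $ i\<bar>) + a / 2 * \<bar>\<Sum>i\<in>UNIV. x $ i\<bar> \<le> 1}"
  then have x: "(l - a) / 2 * (\<Sum>i\<in>UNIV. \<bar>x $ i\<bar>) + a / 2 * \<bar>\<Sum>i\<in>UNIV. x $ i\<bar> \<le> 1" by simp
  have "x \<bullet> y \<le> 1" if "y \<in> isocanted_cube l a" for y
  proof -
    have y: "- (l / 2) \<le> y $ i" "y $ i \<le> l / 2" "y $ i - y $ k \<le> l - a" for i k
      using that a by (cases "i = k"; auto simp: isocanted_cube_def)+
    (* y splits as a point of the cube of side l - a plus a multiple t of (1,...,1) with |t| <= a/2. *)
    define M where "M = Max (range (($) y))"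
    define t where "t = max (M - (l - a) / 2) (- (a / 2))"
    have M: "y $ i \<le> M" for i unfolding M_def by (rule Max_ge) auto
    have "M \<in> range (($) y)" unfolding M_def by (rule Max_in) auto
    then obtain k where k: "M = y $ k" by auto
    \<comment> \<open>\<open>t\<close> is the least number >= -a/2 that keeps every y_i - t at most
      (l - a)/2. The opposite bound on y_i - t comes from the spread bound if the first entry of the
      maximum wins, and from y_i >= -l/2 otherwise.\<close>
    have t: "\<bar>t\<bar> \<le> a / 2" and yt: "\<bar>y $ i - t\<bar> \<le> (l - a) / 2" for i
    proof -
      have *: "y $ k \<le> l / 2" "- (l / 2) \<le> y $ i" "y $ k - y $ i \<le> l - a" "y $ i \<le> M"
        using y M by auto
      then show "\<bar>t\<bar> \<le> a / 2" "\<bar>y $ i - t\<bar> \<le> (l - a) / 2"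
        unfolding t_def k diff_divide_distrib using a by linarith+
    qed
    have "x \<bullet> y = (\<Sum>i\<in>UNIV. x $ i * (y $ i - t)) + t * (\<Sum>i\<in>UNIV. x $ i)"
      by (simp add: inner_vec_def sum_distrib_left sum.distrib[symmetric] algebra_simps)
    also have "\<dots> \<le> (\<Sum>i\<in>UNIV. (l - a) / 2 * \<bar>x $ i\<bar>) + a / 2 * \<bar>\<Sum>i\<in>UNIV. x $ i\<bar>"
    proof (intro add_mono sum_mono)
      fix i
      have "x $ i * (y $ i - t) \<le> \<bar>y $ i - t\<bar> * \<bar>x $ i\<bar>" by (metis abs_ge_self abs_mult mult.commute)
      also have "\<dots> \<le> (l - a) / 2 * \<bar>x $ i\<bar>" using yt by (intro mult_right_mono) auto
      finally show "x $ i * (y $ i - t) \<le> (l - a) / 2 * \<bar>x $ i\<bar>" .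
      have "t * (\<Sum>i\<in>UNIV. x $ i) \<le> \<bar>t\<bar> * \<bar>\<Sum>i\<in>UNIV. x $ i\<bar>" by (metis abs_ge_self abs_mult)
      also have "\<dots> \<le> a / 2 * \<bar>\<Sum>i\<in>UNIV. x $ i\<bar>" using t by (intro mult_right_mono) auto
      finally show "t * (\<Sum>i\<in>UNIV. x $ i) \<le> a / 2 * \<bar>\<Sum>i\<in>UNIV. x $ i\<bar>" .
    qed
    also have "\<dots> \<le> 1" using x by (simp add: sum_distrib_left)
    finally show ?thesis .
  qed
  then show "x \<in> polar_dual (isocanted_cube l a)" by (auto simp: polar_dual_def)
qed

text \<open>Scaling by r = 2 / (l - a) normalises the coefficient of the 1-norm to 1 and that of the
  absolute sum to c. The polar dual is thus r times the ball B, whose volume is known from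
  \<open>emeasure_laplace_ball\<close>.\<close>

lemma measure_polar_dual_isocanted_cube:
  assumes a: "0 < a" "a < l"
  shows "measure lebesgue (polar_dual (isocanted_cube l a :: (real ^ 'n) set))
    = (2 / (l - a)) ^ CARD('n) * laplace_value CARD('n) (a / (l - a)) / fact CARD('n)"
proof -
  let ?P = "polar_dual (isocanted_cube l a :: (real ^ 'n) set)"
  define c r where "c = a / (l - a)" and "r = 2 / (l - a)"
  have c: "c > 0" and r: "r > 0" using a by (auto simp: c_def r_def)
  define B where "B = {x :: real ^ 'n. (\<Sum>i\<in>UNIV. \<bar>x $ i\<bar>) + c * \<bar>\<Sum>i\<in>UNIV. x $ i\<bar> \<le> 1}"
  have P: "?P = {x. (l - a) / 2 * (\<Sum>i\<in>UNIV. \<bar>x $ i\<bar>) + a / 2 * \<bar>\<Sum>i\<in>UNIV. x $ i\<bar> \<le> 1}"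
    by (rule polar_dual_isocanted_cube[OF a])
  have "closed ?P" unfolding P by (intro closed_Collect_le continuous_intros)
  then have borel: "?P \<in> sets borel" by (rule borel_closed)
  have "(l - a) / 2 * (\<Sum>i\<in>UNIV. \<bar>(r *\<^sub>R x) $ i\<bar>) + a / 2 * \<bar>\<Sum>i\<in>UNIV. (r *\<^sub>R x) $ i\<bar>
      = (\<Sum>i\<in>UNIV. \<bar>x $ i\<bar>) + c * \<bar>\<Sum>i\<in>UNIV. x $ i\<bar>" for x :: "real ^ 'n"
  proof -
    have "(\<Sum>i\<in>UNIV. \<bar>(r *\<^sub>R x) $ i\<bar>) = r * (\<Sum>i\<in>UNIV. \<bar>x $ i\<bar>)"
      using r by (simp add: abs_mult sum_distrib_left)
    moreover have "\<bar>\<Sum>i\<in>UNIV. (r *\<^sub>R x) $ i\<bar> = r * \<bar>\<Sum>i\<in>UNIV. x $ i\<bar>"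
      using r by (simp add: abs_mult sum_distrib_left[symmetric])
    moreover have "(l - a) / 2 * r = 1" "a / 2 * r = c" using a by (auto simp: r_def c_def)
    ultimately show ?thesis by (simp only: mult.assoc[symmetric] mult_1)
  qed
  then have "{x. r *\<^sub>R x \<in> ?P} = B" unfolding P B_def by simp
  then have scale: "emeasure lborel ?P = ennreal (r ^ CARD('n)) * emeasure lborel B"
    using emeasure_lborel_scaleR_vimage[OF r borel] by simp
  have B: "ennreal (fact CARD('n)) * emeasure lborel B = ennreal (laplace_value CARD('n) c)"
    unfolding B_def by (rule emeasure_laplace_ball[OF c])
  \<comment> \<open>A positive multiple of this measure is finite, so it can be replaced by a real
    v.\<close>
  then have "emeasure lborel B \<noteq> top" by (auto simp: ennreal_mult_top)
  then obtain v where v: "v \<ge> 0" "emeasure lborel B = ennreal v" by (metis ennreal_cases)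
  have "v = laplace_value CARD('n) c / fact CARD('n)"
    using B v laplace_value_nonneg[of c "CARD('n)"] c by (simp add: ennreal_mult'[symmetric] field_simps)
  then have "emeasure lebesgue ?P = ennreal (r ^ CARD('n) * laplace_value CARD('n) c / fact CARD('n))"
    using borel scale v r by (simp add: ennreal_mult'[symmetric])
  then show ?thesis
    using laplace_value_nonneg[of c "CARD('n)"] c r unfolding measure_def c_def[symmetric] r_def[symmetric] by simp
qed

section \<open>The volume product\<close>

theorem mainTheorem3:
  fixes l a :: real
  assumes "CARD('n::finite) \<ge> 2"
    and "0 < a" and "a < l"
  shows "4 ^ CARD('n) / fact CARD('n)
           \<le> measure lebesgue (isocanted_cube l a :: (real ^ 'n) set)
               * measure lebesgue (polar_dual (isocanted_cube l a :: (real ^ 'n) set))"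
proof -
  let ?d = "CARD('n)"
  define c m where "c = a / (l - a)" and "m = l - a"
  have c: "c > 0" and m: "m > 0" using assms by (auto simp: c_def m_def)
  \<comment> \<open>The closed form in dimension d uses the partial sum of index d - 1; d >= 2 gives
    the n >= 1 that the polynomial inequality requires.\<close>
  obtain n where n: "?d = n + 1" "n \<ge> 1"
    using assms(1) by (intro that[of "?d - 1"]) auto
  have "2 ^ ?d \<le> (1 + real ?d * c) * laplace_value ?d c"
    using binom_sum_lower_bound[OF n(2), of c] c unfolding n(1) by (simp add: laplace_value_def)
  then have "2 ^ ?d * 2 ^ ?d / fact ?d \<le> 2 ^ ?d * ((1 + real ?d * c) * laplace_value ?d c) / fact ?d"
    by (intro divide_right_mono mult_left_mono) auto
  \<comment> \<open>The powers of m = l - a from the two volumes cancel, which leaves an expression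
    in c and d alone.\<close>
  also have "\<dots> = m ^ ?d * (1 + real ?d * c) * ((2 / m) ^ ?d * laplace_value ?d c / fact ?d)"
    using m by (simp add: power_divide field_simps)
  also have "\<dots> = m ^ ?d * (1 + real ?d * c)
      * measure lebesgue (polar_dual (isocanted_cube l a :: (real ^ 'n) set))"
    by (simp add: measure_polar_dual_isocanted_cube[OF assms(2,3)] c_def m_def)
  also have "\<dots> \<le> measure lebesgue (isocanted_cube l a :: (real ^ 'n) set)
      * measure lebesgue (polar_dual (isocanted_cube l a :: (real ^ 'n) set))"
    using measure_isocanted_cube_ge[OF assms(2,3), where 'n = 'n]
    by (intro mult_right_mono) (simp_all add: c_def m_def)
  finally show ?thesis by (simp add: power_mult_distrib[symmetric])
qed

end
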